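(* For the IPLS cost function $$L(x_{1:K})=L^{(i)}_{\mathrm{IPLS}}(x_{1:K})=\tfrac12\Big((x_1-\hat x_{1\mid0})^\top\hat P_{1\mid0}^{-1}(x_1-\hat x_{1\mid0})+\sum_{k=1}^{K-1}(x_{k+1}-\bar x_k(x_k))^\top(Q_k+\Omega^{(i)}_k)^{-1}(x_{k+1}-\bar x_k(x_k))+\sum_{k=1}^{K}(y_k-\bar y_k(x_k))^\top(R_k+\Gamma^{(i)}_k)^{-1}(y_k-\bar y_k(x_k))\Big),$$ the directional derivative at the current iterate $\hat x^{(i)}_{1:K}$ along the search direction $\Delta\hat x^{(i)}_{1:K}=\hat x^{(i+1)}_{1:K}-\hat x^{(i)}_{1:K}$, which is needed to evaluate the Armijo--Wolfe conditions, is given by $$(\Delta\hat x^{(i)}_{1:K})^\top\nabla L(\hat x^{(i)}_{1:K})=(\Delta\hat x^{(i)}_1)^\top\hat P_{1\mid0}^{-1}(\hat x^{(i)}_1-\hat x_{1\mid0})+\sum_{k=1}^{K-1}\big(\Delta\hat x^{(i)}_{k+1}-F_k(\hat x^{(i)}_k)\Delta\hat x^{(i)}_k\big)^\top(Q_k+\Omega^{(i)}_k)^{-1}\big(\hat x^{(i)}_{k+1}-\bar x_k(\hat x^{(i)}_k)\big)-\sum_{k=1}^{K}\big(H_k(\hat x^{(i)}_k)\Delta\hat x^{(i)}_k\big)^\top(R_k+\Gamma^{(i)}_k)^{-1}\big(y_k-\bar y_k(\hat x^{(i)}_k)\big).$$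
   Context: Setting: state-space model $x_{k+1}=f_k(x_k)+q_k$, $q_k\sim\mathcal N(0,Q_k)$, $y_k=h_k(x_k)+r_k$, $r_k\sim\mathcal N(0,R_k)$, $x_1\sim\mathcal N(\hat x_{1\mid0},\hat P_{1\mid0})$, with $f_k:\mathbb R^{d_x}\to\mathbb R^{d_x}$, $h_k:\mathbb R^{d_x}\to\mathbb R^{d_y}$ and independent noises. $\hat x^{(i)}_{1:K}$ and $\hat P^{(i)}_{1:K}$ are the current mean and covariance estimates; $x_{1:K}$ is identified with the stacked vector. $\hat P_{1\mid0}$, $\hat P^{(i)}_k$, $Q_k+\Omega^{(i)}_k$, $R_k+\Gamma^{(i)}_k$ are symmetric positive definite, and all Gaussian moments below are finite (at every point $x$). Statistical linear regression (SLR). For $x\in\mathbb R^{d_x}$, let $p(\xi)=\mathcal N(\xi;x,\hat P^{(i)}_k)$ and define $\bar x_k(x)=\int f_k(\xi)p(\xi)\,d\xi$, $\Psi_{f_k}(x)=\int(\xi-x)(f_k(\xi)-\bar x_k(x))^\top p(\xi)\,d\xi$, $\Phi_{f_k}(x)=\int(f_k(\xi)-\bar x_k(x))(f_k(\xi)-\bar x_k(x))^\top p(\xi)\,d\xi$, $F_k(x)=\Psi_{f_k}(x)^\top(\hat P^{(i)}_k)^{-1}$, $b_k(x)=\bar x_k(x)-F_k(x)x$, $\Omega_k(x)=\Phi_{f_k}(x)-F_k(x)\hat P^{(i)}_kF_k(x)^\top$. With $h_k$ in place of $f_k$ one defines analogously $\bar y_k(x)$, $H_k(x)$, $c_k(x)$,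 $\Gamma_k(x)$. Put $\Omega^{(i)}_k=\Omega_k(\hat x^{(i)}_k)$ and $\Gamma^{(i)}_k=\Gamma_k(\hat x^{(i)}_k)$; these are fixed and do not depend on the optimisation variable $x_{1:K}$. The proposed iterate $\hat x^{(i+1)}_{1:K}$ is the output of one iteration of the iterated posterior linearisation smoother (IPLS): the sequence of posterior means of $x_1,\dots,x_K$ given $y_{1:K}$ in the affine Gaussian model $x_{k+1}=F_k(\hat x^{(i)}_k)x_k+b_k(\hat x^{(i)}_k)+\omega_k+q_k$, $y_k=H_k(\hat x^{(i)}_k)x_k+c_k(\hat x^{(i)}_k)+\gamma_k+r_k$ with independent noises $\omega_k\sim\mathcal N(0,\Omega^{(i)}_k)$, $\gamma_k\sim\mathcal N(0,\Gamma^{(i)}_k)$. The Armijo--Wolfe conditions for the point $\hat x(\alpha)=\hat x^{(i)}_{1:K}+\alpha\,\Delta\hat x^{(i)}_{1:K}$, with constants $0<c_1<c_2<1$, are $L(\hat x(\alpha))\le L(\hat x^{(i)}_{1:K})+c_1\alpha(\Delta\hat x^{(i)}_{1:K})^\top\nabla L(\hat x^{(i)}_{1:K})$ and $(\Delta\hat x^{(i)}_{1:K})^\top\nabla L(\hat x(\alpha))\ge c_2(\Delta\hat x^{(i)}_{1:K})^\top\nabla L(\hat x^{(i)}_{1:K})$. *)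

theory Defs
  imports "HOL-Analysis.Analysis"
begin

definition sym_pos_def :: "real^'n^'n \<Rightarrow> bool" where
  "sym_pos_def A \<longleftrightarrow> transpose A = A \<and> (\<forall>v. v \<noteq> 0 \<longrightarrow> v \<bullet> (A *v v) > 0)"

definition sym_pos_semidef :: "real^'n^'n \<Rightarrow> bool" where
  "sym_pos_semidef A \<longleftrightarrow> transpose A = A \<and> (\<forall>v. v \<bullet> (A *v v) \<ge> 0)"

text \<open>Lebesgue density of the Gaussian with mean \<open>m\<close> and positive definite covariance \<open>P\<close>.\<close>

definition gauss_density :: "real^'n \<Rightarrow> real^'n^'n \<Rightarrow> real^'n \<Rightarrow> real" where
  "gauss_density m P \<xi> =
     exp (- ((\<xi> - m) \<bullet> (matrix_inv P *v (\<xi> - m))) / 2) / sqrt ((2 * pi) ^ CARD('n) * det P)"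

definition outer :: "real^'n \<Rightarrow> real^'m \<Rightarrow> real^'m^'n" where
  "outer u v = (\<chi> i j. u $ i * v $ j)"


section \<open>Statistical linear regression\<close>

text \<open>
  Statistical linear regression of \<open>g\<close> about \<open>x\<close> with respect to the Gaussian with mean \<open>x\<close> and
  covariance \<open>P\<close>. For \<open>g = f\<^sub>k\<close> the functions below are the paper's \<open>x\<close>-bar\<open>\<^sub>k\<close>, \<open>\<Psi>\<close>, \<open>\<Phi>\<close>, \<open>F\<^sub>k\<close>,
  \<open>b\<^sub>k\<close> and \<open>\<Omega>\<^sub>k\<close>; for \<open>g = h\<^sub>k\<close> they are \<open>y\<close>-bar\<open>\<^sub>k\<close>, \<open>\<Psi>\<close>, \<open>\<Phi>\<close>, \<open>H\<^sub>k\<close>, \<open>c\<^sub>k\<close> and \<open>\<Gamma>\<^sub>k\<close>.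
\<close>

definition slr_mean :: "(real^'n \<Rightarrow> real^'m) \<Rightarrow> real^'n^'n \<Rightarrow> real^'n \<Rightarrow> real^'m" where
  "slr_mean g P x = (\<integral>\<xi>. gauss_density x P \<xi> *\<^sub>R g \<xi> \<partial>lborel)"

definition slr_Psi :: "(real^'n \<Rightarrow> real^'m) \<Rightarrow> real^'n^'n \<Rightarrow> real^'n \<Rightarrow> real^'m^'n" where
  "slr_Psi g P x =
     (\<integral>\<xi>. gauss_density x P \<xi> *\<^sub>R outer (\<xi> - x) (g \<xi> - slr_mean g P x) \<partial>lborel)"

definition slr_Phi :: "(real^'n \<Rightarrow> real^'m) \<Rightarrow> real^'n^'n \<Rightarrow> real^'n \<Rightarrow> real^'m^'m" where
  "slr_Phi g P x =
     (\<integral>\<xi>. gauss_density x P \<xi> *\<^sub>R outer (g \<xi> - slr_mean g P x) (g \<xi> - slr_mean g P x) \<partial>lborel)"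

definition slr_gain :: "(real^'n \<Rightarrow> real^'m) \<Rightarrow> real^'n^'n \<Rightarrow> real^'n \<Rightarrow> real^'n^'m" where
  "slr_gain g P x = transpose (slr_Psi g P x) ** matrix_inv P"

definition slr_offset :: "(real^'n \<Rightarrow> real^'m) \<Rightarrow> real^'n^'n \<Rightarrow> real^'n \<Rightarrow> real^'m" where
  "slr_offset g P x = slr_mean g P x - slr_gain g P x *v x"

definition slr_resid :: "(real^'n \<Rightarrow> real^'m) \<Rightarrow> real^'n^'n \<Rightarrow> real^'n \<Rightarrow> real^'m^'m" where
  "slr_resid g P x = slr_Phi g P x - slr_gain g P x ** P ** transpose (slr_gain g P x)"

text \<open>
  Finiteness of the Gaussian moments at every point. Bochner integrals of non-integrable functions
  are \<open>0\<close> by convention, so this also ensures that the definitions above have their usual meaning.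
\<close>

definition finite_slr_moments :: "(real^'n \<Rightarrow> real^'m) \<Rightarrow> real^'n^'n \<Rightarrow> bool" where
  "finite_slr_moments g P \<longleftrightarrow> (\<forall>x.
     integrable lborel (\<lambda>\<xi>. gauss_density x P \<xi> *\<^sub>R g \<xi>) \<and>
     integrable lborel (\<lambda>\<xi>. gauss_density x P \<xi> *\<^sub>R outer (\<xi> - x) (g \<xi> - slr_mean g P x)) \<and>
     integrable lborel
       (\<lambda>\<xi>. gauss_density x P \<xi> *\<^sub>R outer (g \<xi> - slr_mean g P x) (g \<xi> - slr_mean g P x)))"


section \<open>Smoothing in an affine Gaussian state-space model\<close>

text \<open>
  A trajectory \<open>x\<^sub>1, \<dots>, x\<^sub>K\<close> in dimension \<open>CARD('n)\<close> is a stacked vector \<open>z :: real^'n^'k\<close> with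
  \<open>CARD('k) = K\<close>. A bijection \<open>s\<close> from \<open>{1..K}\<close> onto \<open>'k\<close> tells in which block the state at a given
  time is stored, so that \<open>x\<^sub>k\<close> is \<open>z $ s k\<close>.

  The next definition is the joint density of the states \<open>z\<close> and the observations \<open>y\<^sub>1, \<dots>, y\<^sub>K\<close> in
  the model with initial law \<open>N(m0, P0)\<close>, transitions \<open>x\<^bsub>k+1\<^esub> = A\<^sub>k x\<^sub>k + b\<^sub>k + N(0, S\<^sub>k)\<close> and
  observations \<open>y\<^sub>k = C\<^sub>k x\<^sub>k + c\<^sub>k + N(0, T\<^sub>k)\<close>, where all noises are independent.
\<close>

definition affine_joint_density ::
  "nat \<Rightarrow> (nat \<Rightarrow> 'k) \<Rightarrow> real^'n \<Rightarrow> real^'n^'n \<Rightarrow>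
   (nat \<Rightarrow> real^'n^'n) \<Rightarrow> (nat \<Rightarrow> real^'n) \<Rightarrow> (nat \<Rightarrow> real^'n^'n) \<Rightarrow>
   (nat \<Rightarrow> real^'n^'m) \<Rightarrow> (nat \<Rightarrow> real^'m) \<Rightarrow> (nat \<Rightarrow> real^'m^'m) \<Rightarrow>
   (nat \<Rightarrow> real^'m) \<Rightarrow> real^'n^'k \<Rightarrow> real" where
  "affine_joint_density K s m0 P0 A b S C c T y z =
     gauss_density m0 P0 (z $ s 1) *
     (\<Prod>k=1..<K. gauss_density (A k *v (z $ s k) + b k) (S k) (z $ s (k + 1))) *
     (\<Prod>k=1..K. gauss_density (C k *v (z $ s k) + c k) (T k) (y k))"

text \<open>The stacked posterior mean of the states given \<open>y\<^sub>1, \<dots>, y\<^sub>K\<close>, by Bayes' rule.\<close>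

definition affine_posterior_mean ::
  "nat \<Rightarrow> (nat \<Rightarrow> 'k) \<Rightarrow> real^'n \<Rightarrow> real^'n^'n \<Rightarrow>
   (nat \<Rightarrow> real^'n^'n) \<Rightarrow> (nat \<Rightarrow> real^'n) \<Rightarrow> (nat \<Rightarrow> real^'n^'n) \<Rightarrow>
   (nat \<Rightarrow> real^'n^'m) \<Rightarrow> (nat \<Rightarrow> real^'m) \<Rightarrow> (nat \<Rightarrow> real^'m^'m) \<Rightarrow>
   (nat \<Rightarrow> real^'m) \<Rightarrow> real^'n^'k" where
  "affine_posterior_mean K s m0 P0 A b S C c T y =
     (\<integral>z. (affine_joint_density K s m0 P0 A b S C c T y z /
           (\<integral>w. affine_joint_density K s m0 P0 A b S C c T y w \<partial>lborel)) *\<^sub>R z \<partial>lborel)"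


section \<open>Iterated posterior linearisation smoother\<close>

text \<open>
  One iteration, from the current means \<open>xhat\<close> and covariances \<open>P\<close>: the models \<open>f\<^sub>k\<close> and \<open>h\<^sub>k\<close> are
  replaced by their statistical linear regressions about \<open>xhat\<close>. A sum of independent centred
  Gaussians is Gaussian with the sum of the covariances, so the total process noise has covariance
  \<open>Q\<^sub>k + \<Omega>\<^sub>k\<close> and the total measurement noise has covariance \<open>R\<^sub>k + \<Gamma>\<^sub>k\<close>. The summands themselves may
  be degenerate.
\<close>

definition ipls_update ::
  "nat \<Rightarrow> (nat \<Rightarrow> 'k) \<Rightarrow> real^'n \<Rightarrow> real^'n^'n \<Rightarrow>
   (nat \<Rightarrow> real^'n \<Rightarrow> real^'n) \<Rightarrow> (nat \<Rightarrow> real^'n^'n) \<Rightarrow>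
   (nat \<Rightarrow> real^'n \<Rightarrow> real^'m) \<Rightarrow> (nat \<Rightarrow> real^'m^'m) \<Rightarrow>
   (nat \<Rightarrow> real^'m) \<Rightarrow> (nat \<Rightarrow> real^'n^'n) \<Rightarrow> real^'n^'k \<Rightarrow> real^'n^'k" where
  "ipls_update K s m0 P0 f Q h R y P xhat =
     affine_posterior_mean K s m0 P0
       (\<lambda>k. slr_gain (f k) (P k) (xhat $ s k))
       (\<lambda>k. slr_offset (f k) (P k) (xhat $ s k))
       (\<lambda>k. Q k + slr_resid (f k) (P k) (xhat $ s k))
       (\<lambda>k. slr_gain (h k) (P k) (xhat $ s k))
       (\<lambda>k. slr_offset (h k) (P k) (xhat $ s k))
       (\<lambda>k. R k + slr_resid (h k) (P k) (xhat $ s k))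
       y"

text \<open>
  The weights use the residual covariances at the fixed current iterate \<open>xhat\<close>, while the regression
  means are evaluated at the optimisation variable \<open>z\<close>.
\<close>

definition ipls_cost ::
  "nat \<Rightarrow> (nat \<Rightarrow> 'k) \<Rightarrow> real^'n \<Rightarrow> real^'n^'n \<Rightarrow>
   (nat \<Rightarrow> real^'n \<Rightarrow> real^'n) \<Rightarrow> (nat \<Rightarrow> real^'n^'n) \<Rightarrow>
   (nat \<Rightarrow> real^'n \<Rightarrow> real^'m) \<Rightarrow> (nat \<Rightarrow> real^'m^'m) \<Rightarrow>
   (nat \<Rightarrow> real^'m) \<Rightarrow> (nat \<Rightarrow> real^'n^'n) \<Rightarrow> real^'n^'k \<Rightarrow> real^'n^'k \<Rightarrow> real" where
  "ipls_cost K s m0 P0 f Q h R y P xhat z = 1 / 2 *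
     ((z $ s 1 - m0) \<bullet> (matrix_inv P0 *v (z $ s 1 - m0))
      + (\<Sum>k=1..<K.
          (z $ s (k + 1) - slr_mean (f k) (P k) (z $ s k)) \<bullet>
          (matrix_inv (Q k + slr_resid (f k) (P k) (xhat $ s k)) *v
            (z $ s (k + 1) - slr_mean (f k) (P k) (z $ s k))))
      + (\<Sum>k=1..K.
          (y k - slr_mean (h k) (P k) (z $ s k)) \<bullet>
          (matrix_inv (R k + slr_resid (h k) (P k) (xhat $ s k)) *v
            (y k - slr_mean (h k) (P k) (z $ s k)))))"

end

theory Submission
  imports Defs
begin

text \<open>
  Shifting the mean of the Gaussian by \<open>u\<close> multiplies its density by
  \<open>exp (u \<bullet> a - u \<bullet> P\<^sup>-\<^sup>1 u / 2)\<close> with \<open>a = P\<^sup>-\<^sup>1 (\<xi> - x)\<close>, so the regression mean is, up to a smooth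
  factor with value \<open>1\<close> and derivative \<open>0\<close> at \<open>u = 0\<close>, the Laplace transform
  \<open>u \<mapsto> \<integral> exp (u \<bullet> a) N g\<close>. As it converges at every \<open>u\<close>, it can be differentiated at \<open>0\<close>
  under the integral, which gives \<open>\<Psi>\<^sup>T P\<^sup>-\<^sup>1\<close>, i.e. the regression gain. The rest is the chain rule
  for quadratic forms.
\<close>

section \<open>Differentiating a Laplace transform at the origin\<close>

text \<open>Taylor's formula with Lagrange remainder: the intermediate point \<open>r\<close>
  satisfies \<open>exp r \<le> exp \<bar>t\<bar>\<close>, and the factor 1/2 is dropped.\<close>

lemma abs_exp_minus_linear_le:
  fixes t :: real
  shows "\<bar>exp t - 1 - t\<bar> \<le> exp \<bar>t\<bar> * t\<^sup>2"
proof -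
  obtain r where r: "\<bar>r\<bar> \<le> \<bar>t\<bar>"
    and e: "exp t = (\<Sum>m<2. t ^ m / fact m) + exp r / fact 2 * t ^ 2"
    using Maclaurin_exp_le[of t 2] by blast
  have "\<bar>exp t - 1 - t\<bar> = exp r * t\<^sup>2 / 2"
    by (simp add: e numeral_2_eq_2)
  also have "\<dots> \<le> exp r * t\<^sup>2"
    by simp
  also have "\<dots> \<le> exp \<bar>t\<bar> * t\<^sup>2"
    using r by (intro mult_right_mono) auto
  finally show ?thesis .
qed

text \<open>Reduces an exponential of the norm to finitely many exponentials of linear functionals,
  whose integrability is what a Laplace transform provides. Some coordinate of \<open>a\<close> has
  modulus at least \<open>norm a / n\<close>, because the l1 norm dominates \<open>norm a\<close>;
  the two signs of \<open>b\<close> account for the sign of that coordinate.\<close>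

lemma exp_norm_le_sum_Basis:
  fixes a :: "'b::euclidean_space"
  defines "n \<equiv> real DIM('b)"
  assumes "c \<ge> 0"
  shows "exp (c * norm a) \<le> (\<Sum>b\<in>Basis. exp (((c * n) *\<^sub>R b) \<bullet> a) + exp ((- (c * n) *\<^sub>R b) \<bullet> a))"
proof -
  have "\<exists>b\<in>Basis. norm a \<le> n * \<bar>a \<bullet> b\<bar>"
  proof (rule ccontr)
    assume "\<not> ?thesis"
    then have "\<And>b. b \<in> Basis \<Longrightarrow> \<bar>a \<bullet> b\<bar> < norm a / n"
      by (auto simp: n_def field_simps not_le)
    then have "(\<Sum>b\<in>Basis. \<bar>a \<bullet> b\<bar>) < (\<Sum>b\<in>(Basis::'b set). norm a / n)"
      by (intro sum_strict_mono) auto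
    also have "\<dots> = norm a"
      by (simp add: n_def)
    finally show False
      using norm_le_l1[of a] by simp
  qed
  then obtain b where b: "b \<in> Basis" "norm a \<le> n * \<bar>a \<bullet> b\<bar>"
    by blast
  have "c * norm a \<le> c * (n * \<bar>a \<bullet> b\<bar>)"
    using b assms by (intro mult_left_mono)
  then have "exp (c * norm a) \<le> exp (c * (n * \<bar>a \<bullet> b\<bar>))"
    by simp
  also have "\<dots> \<le> exp (((c * n) *\<^sub>R b) \<bullet> a) + exp ((- (c * n) *\<^sub>R b) \<bullet> a)"
    by (cases "a \<bullet> b \<ge> 0") (auto simp: inner_commute mult_ac)
  also have "\<dots> \<le> (\<Sum>b\<in>Basis. exp (((c * n) *\<^sub>R b) \<bullet> a) + exp ((- (c * n) *\<^sub>R b) \<bullet> a))"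
    using b by (intro member_le_sum) auto
  finally show ?thesis .
qed

text \<open>One dominating function \<open>W\<close> serves both claims. Convergence at every
  \<open>u\<close> makes \<open>W\<close> integrable; it bounds the linear term by
  \<open>norm u * W\<close> and, for \<open>norm u \<le> 1\<close>, the Taylor remainder by a
  multiple of \<open>(norm u)\<^sup>2 * W\<close>.\<close>

lemma
  fixes a :: "'a \<Rightarrow> 'b::euclidean_space" and G :: "'a \<Rightarrow> 'c::{banach, second_countable_topology}"
  assumes a [measurable]: "a \<in> borel_measurable M"
    and int: "\<And>u. integrable M (\<lambda>\<xi>. exp (u \<bullet> a \<xi>) *\<^sub>R G \<xi>)"
  shows integrable_inner_scaleR: "\<And>u. integrable M (\<lambda>\<xi>. (u \<bullet> a \<xi>) *\<^sub>R G \<xi>)"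
    and has_derivative_laplace_0:
      "((\<lambda>u. \<integral>\<xi>. exp (u \<bullet> a \<xi>) *\<^sub>R G \<xi> \<partial>M) has_derivative (\<lambda>u. \<integral>\<xi>. (u \<bullet> a \<xi>) *\<^sub>R G \<xi> \<partial>M)) (at 0)"
proof -
  have G: "integrable M G"
    using int[of 0] by simp
  then have [measurable]: "G \<in> borel_measurable M"
    by auto
  \<comment> \<open>The constant 2 leaves room for two factors \<open>exp (norm (a \<xi>))\<close>:
    one bounds the exponential in the Taylor remainder, the other absorbs the square of
    \<open>norm (a \<xi>)\<close>.\<close>
  define W where "W \<xi> = exp (2 * norm (a \<xi>)) * norm (G \<xi>)" for \<xi>
  have W: "integrable M W"
  proof (rule Bochner_Integration.integrable_bound)
    \<comment> \<open>This is \<open>c * n\<close> from \<open>exp_norm_le_sum_Basis\<close> with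
      \<open>c = 2\<close>.\<close>
    let ?n = "2 * real DIM('b)"
    show "integrable M (\<lambda>\<xi>. \<Sum>b\<in>Basis.
        norm (exp ((?n *\<^sub>R b) \<bullet> a \<xi>) *\<^sub>R G \<xi>) + norm (exp ((- ?n *\<^sub>R b) \<bullet> a \<xi>) *\<^sub>R G \<xi>))"
      by (intro Bochner_Integration.integrable_sum Bochner_Integration.integrable_add integrable_norm int)
    show "W \<in> borel_measurable M"
      unfolding W_def by measurable
    show "AE \<xi> in M. norm (W \<xi>) \<le> norm (\<Sum>b\<in>Basis.
        norm (exp ((?n *\<^sub>R b) \<bullet> a \<xi>) *\<^sub>R G \<xi>) + norm (exp ((- ?n *\<^sub>R b) \<bullet> a \<xi>) *\<^sub>R G \<xi>))"
    proof (rule AE_I2)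
      fix \<xi>
      have "W \<xi> \<le> (\<Sum>b\<in>Basis. exp ((?n *\<^sub>R b) \<bullet> a \<xi>) + exp ((- ?n *\<^sub>R b) \<bullet> a \<xi>)) * norm (G \<xi>)"
        unfolding W_def by (intro mult_right_mono exp_norm_le_sum_Basis) auto
      also have "\<dots> = (\<Sum>b\<in>Basis.
        norm (exp ((?n *\<^sub>R b) \<bullet> a \<xi>) *\<^sub>R G \<xi>) + norm (exp ((- ?n *\<^sub>R b) \<bullet> a \<xi>) *\<^sub>R G \<xi>))"
        by (simp add: sum_distrib_right distrib_right)
      finally show "norm (W \<xi>) \<le> norm (\<Sum>b\<in>Basis.
        norm (exp ((?n *\<^sub>R b) \<bullet> a \<xi>) *\<^sub>R G \<xi>) + norm (exp ((- ?n *\<^sub>R b) \<bullet> a \<xi>) *\<^sub>R G \<xi>))"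
        by (simp add: W_def)
    qed
  qed
  have W_nonneg: "W \<xi> \<ge> 0" for \<xi>
    by (simp add: W_def)
  have lin: "norm ((u \<bullet> a \<xi>) *\<^sub>R G \<xi>) \<le> norm u * W \<xi>" for u \<xi>
  proof -
    have "norm (a \<xi>) \<le> exp (2 * norm (a \<xi>))"
      using exp_ge_add_one_self[of "2 * norm (a \<xi>)"] norm_ge_zero[of "a \<xi>"] by linarith
    then have "\<bar>u \<bullet> a \<xi>\<bar> \<le> norm u * exp (2 * norm (a \<xi>))"
      using Cauchy_Schwarz_ineq2[of u "a \<xi>"] by (meson order_trans mult_left_mono norm_ge_zero)
    then have "\<bar>u \<bullet> a \<xi>\<bar> * norm (G \<xi>) \<le> norm u * exp (2 * norm (a \<xi>)) * norm (G \<xi>)"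
      by (intro mult_right_mono) auto
    then show ?thesis
      by (simp add: W_def mult_ac)
  qed
  show int_lin: "integrable M (\<lambda>\<xi>. (u \<bullet> a \<xi>) *\<^sub>R G \<xi>)" for u
  proof (rule Bochner_Integration.integrable_bound)
    show "integrable M (\<lambda>\<xi>. norm u * W \<xi>)"
      using W by simp
    show "AE \<xi> in M. norm ((u \<bullet> a \<xi>) *\<^sub>R G \<xi>) \<le> norm (norm u * W \<xi>)"
      using lin[of u] W_nonneg by (simp add: abs_mult)
  qed measurable
  have quad: "norm (exp (u \<bullet> a \<xi>) *\<^sub>R G \<xi> - G \<xi> - (u \<bullet> a \<xi>) *\<^sub>R G \<xi>) \<le> 2 * (norm u)\<^sup>2 * W \<xi>"
    if u: "norm u \<le> 1" for u \<xi>
  proof -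
    let ?t = "u \<bullet> a \<xi>" and ?r = "norm (a \<xi>)"
    have t: "\<bar>?t\<bar> \<le> norm u * ?r"
      by (rule Cauchy_Schwarz_ineq2)
    also have "\<dots> \<le> ?r"
      using u by (simp add: mult_left_le_one_le)
    finally have e: "exp \<bar>?t\<bar> \<le> exp ?r"
      by simp
    have t2: "?t\<^sup>2 \<le> (norm u)\<^sup>2 * ?r\<^sup>2"
      using power_mono[OF t, of 2] by (simp add: power_mult_distrib)
    have r2: "?r\<^sup>2 \<le> 2 * exp ?r"
      using exp_lower_Taylor_quadratic[of ?r] norm_ge_zero[of "a \<xi>"] by linarith
    have "exp \<bar>?t\<bar> * ?t\<^sup>2 \<le> exp ?r * ((norm u)\<^sup>2 * (2 * exp ?r))"
      using e t2 r2 by (intro mult_mono order_trans[OF t2] mult_left_mono) auto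
    also have "\<dots> = 2 * (norm u)\<^sup>2 * exp (2 * ?r)"
      by (simp add: mult_ac flip: exp_add)
    finally have "\<bar>exp ?t - 1 - ?t\<bar> \<le> 2 * (norm u)\<^sup>2 * exp (2 * ?r)"
      using abs_exp_minus_linear_le[of ?t] by linarith
    then have "\<bar>exp ?t - 1 - ?t\<bar> * norm (G \<xi>) \<le> 2 * (norm u)\<^sup>2 * exp (2 * ?r) * norm (G \<xi>)"
      by (intro mult_right_mono) auto
    moreover have "exp ?t *\<^sub>R G \<xi> - G \<xi> - ?t *\<^sub>R G \<xi> = (exp ?t - 1 - ?t) *\<^sub>R G \<xi>"
      by (simp add: algebra_simps)
    ultimately show ?thesis
      by (simp add: W_def mult_ac)
  qed
  let ?E = "\<lambda>u. \<integral>\<xi>. exp (u \<bullet> a \<xi>) *\<^sub>R G \<xi> \<partial>M" and ?D = "\<lambda>u. \<integral>\<xi>. (u \<bullet> a \<xi>) *\<^sub>R G \<xi> \<partial>M"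
  \<comment> \<open>Additivity of the integral rests on \<open>int_lin\<close>; boundedness then
    follows since the domain is finite-dimensional.\<close>
  have "linear ?D"
    by (rule linearI)
      (simp_all add: inner_add_left scaleR_add_left int_lin flip: scaleR_scaleR)
  then have "bounded_linear ?D"
    by (simp add: linear_conv_bounded_linear)
  then show "(?E has_derivative ?D) (at 0)"
  \<comment> \<open>The radius 1 is the range in which \<open>quad\<close> holds; there the
    difference quotient is squeezed by a multiple of \<open>norm u\<close>.\<close>
  proof (rule has_derivativeI_sandwich[of 1, rotated])
    show "((\<lambda>u. norm u * (2 * integral\<^sup>L M W)) \<longlongrightarrow> 0) (at (0::'b))"
      by (auto intro!: tendsto_eq_intros)
    fix u :: 'b
    assume "u \<noteq> 0" "dist u 0 < 1"
    then have u: "norm u \<le> 1" "norm u > 0"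
      by auto
    have "norm (?E u - ?E 0 - ?D (u - 0))
        = norm (\<integral>\<xi>. exp (u \<bullet> a \<xi>) *\<^sub>R G \<xi> - G \<xi> - (u \<bullet> a \<xi>) *\<^sub>R G \<xi> \<partial>M)"
      using int int_lin G by simp
    also have "\<dots> \<le> (\<integral>\<xi>. norm (exp (u \<bullet> a \<xi>) *\<^sub>R G \<xi> - G \<xi> - (u \<bullet> a \<xi>) *\<^sub>R G \<xi>) \<partial>M)"
      by (rule integral_norm_bound)
    also have "\<dots> \<le> (\<integral>\<xi>. 2 * (norm u)\<^sup>2 * W \<xi> \<partial>M)"
      using int int_lin G W quad[OF u(1)] by (intro integral_mono) auto
    also have "\<dots> = norm u * (norm u * (2 * integral\<^sup>L M W))"
      by (simp add: power2_eq_square mult_ac)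
    finally show "norm (?E u - ?E 0 - ?D (u - 0)) / norm (u - 0) \<le> norm u * (2 * integral\<^sup>L M W)"
      using u(2) by (simp add: divide_le_eq mult_ac)
  qed simp
qed

section \<open>The derivative of the regression mean\<close>

lemma invertible_if_sym_pos_def:
  assumes "sym_pos_def A"
  shows "invertible A"
proof -
  have "v = 0" if "A *v v = 0" for v
    using assms that unfolding sym_pos_def_def by (metis inner_zero_right less_irrefl)
  then show ?thesis
    by (simp add: invertible_left_inverse matrix_left_invertible_ker)
qed

text \<open>The inverse inherits symmetry: write \<open>u\<close> and \<open>v\<close> as
  \<open>A\<close> applied to their preimages and move \<open>A\<close> across the inner
  product.\<close>

lemma inner_matrix_inv_commute:
  fixes u v :: "real^'n::finite"
  assumes "sym_pos_def A"
  shows "u \<bullet> (matrix_inv A *v v) = v \<bullet> (matrix_inv A *v u)"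
proof -
  have A: "invertible A" "transpose A = A"
    using assms invertible_if_sym_pos_def by (auto simp: sym_pos_def_def)
  have "A *v (matrix_inv A *v w) = w" for w
  proof -
    \<comment> \<open>\<open>matrix_inv\<close> is a choice operator, so its inverse property has to
      be extracted from invertibility.\<close>
    have "A ** matrix_inv A = mat 1"
      using A(1) someI_ex[of "\<lambda>B. A ** B = mat 1 \<and> B ** A = mat 1"]
      unfolding invertible_def matrix_inv_def by blast
    then show ?thesis
      by (simp add: matrix_vector_mul_assoc)
  qed
  then show ?thesis
    by (metis A(2) dot_lmul_matrix inner_commute vector_transpose_matrix)
qed

text \<open>Expand the quadratic form at \<open>\<xi> - x - u\<close>: the two mixed terms agree by
  symmetry of the inverse, and the normalising constant does not depend on the mean.\<close>

lemma gauss_density_shift: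
  assumes "sym_pos_def P"
  shows "gauss_density (x + u) P \<xi> =
    exp (- (u \<bullet> (matrix_inv P *v u)) / 2) * (exp (u \<bullet> (matrix_inv P *v (\<xi> - x))) * gauss_density x P \<xi>)"
proof -
  let ?W = "matrix_inv P" and ?d = "\<xi> - x"
  have shift: "\<xi> - (x + u) = ?d - u"
    by simp
  have square: "(d - u) \<bullet> (?W *v (d - u)) = d \<bullet> (?W *v d) - 2 * (u \<bullet> (?W *v d)) + u \<bullet> (?W *v u)" for d
    using inner_matrix_inv_commute[OF assms, of d u]
    by (simp add: matrix_vector_mult_diff_distrib inner_diff_left inner_diff_right)
  have "- ((\<xi> - (x + u)) \<bullet> (?W *v (\<xi> - (x + u)))) / 2 =
      - (u \<bullet> (?W *v u)) / 2 + (u \<bullet> (?W *v ?d) + - (?d \<bullet> (?W *v ?d)) / 2)"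
    unfolding shift square by (simp add: diff_divide_distrib add_divide_distrib)
  then have "exp (- ((\<xi> - (x + u)) \<bullet> (?W *v (\<xi> - (x + u)))) / 2) =
      exp (- (u \<bullet> (?W *v u)) / 2) * (exp (u \<bullet> (?W *v ?d)) * exp (- (?d \<bullet> (?W *v ?d)) / 2))"
    by (simp only: exp_add)
  then show ?thesis
    unfolding gauss_density_def by simp
qed

lemma gauss_density_reflect: "gauss_density x P (2 *\<^sub>R x - \<xi>) = gauss_density x P \<xi>"
proof -
  have "2 *\<^sub>R x - \<xi> - x = - (\<xi> - x)"
    by (simp add: scaleR_2)
  then show ?thesis
    unfolding gauss_density_def by (simp only: linear_neg[OF matrix_vector_mul_linear] inner_minus_left inner_minus_right minus_minus)
qed

text \<open>The integrand is odd about \<open>x\<close> and Lebesgue measure is invariant under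
  reflection in \<open>x\<close>, so the integral equals its own negative. The argument also covers
  a non-integrable integrand, whose integral is 0 by default.\<close>

lemma integral_gauss_density_odd:
  fixes x u :: "real^'n::finite" and c :: "real^'m::finite"
  shows "(\<integral>\<xi>. gauss_density x P \<xi> *\<^sub>R (u \<bullet> (matrix_inv P *v (\<xi> - x))) *\<^sub>R c \<partial>lborel) = 0"
    (is "integral\<^sup>L lborel ?g = 0")
proof -
  have [measurable]: "(\<lambda>\<xi>. A *v (\<xi> - x)) \<in> borel_measurable borel" for A :: "real^'n^'n"
    by (intro borel_measurable_continuous_onI
        bounded_linear.continuous_on[OF matrix_vector_mul_bounded_linear] continuous_intros)
  have g: "?g \<in> borel_measurable borel"
    unfolding gauss_density_def by measurable
  have "?g (2 *\<^sub>R x - \<xi>) = - ?g \<xi>" for \<xi>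
  proof -
    have "2 *\<^sub>R x - \<xi> - x = - (\<xi> - x)"
      by (simp add: scaleR_2)
    then show ?thesis
      by (simp only: gauss_density_reflect linear_neg[OF matrix_vector_mul_linear] inner_minus_right
          scaleR_minus_left scaleR_minus_right)
  qed
  moreover have "integral\<^sup>L lborel ?g = (\<integral>\<xi>. ?g (2 *\<^sub>R x - \<xi>) \<partial>lborel)"
  proof -
    \<comment> \<open>Affine image with scale factor -1, whose Jacobian has modulus 1.\<close>
    have "lborel = distr lborel borel (\<lambda>\<xi>. 2 *\<^sub>R x - \<xi>)"
      using lborel_affine[of "-1" "2 *\<^sub>R x"] by (simp add: density_1)
    then have "integral\<^sup>L lborel ?g = integral\<^sup>L (distr lborel borel (\<lambda>\<xi>. 2 *\<^sub>R x - \<xi>)) ?g"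
      by simp
    then show ?thesis
      using integral_distr[OF _ g, of "\<lambda>\<xi>. 2 *\<^sub>R x - \<xi>" lborel] by simp
  qed
  ultimately have "integral\<^sup>L lborel ?g = - integral\<^sup>L lborel ?g"
    by simp
  then have "2 *\<^sub>R integral\<^sup>L lborel ?g = 0"
    by (simp only: scaleR_2 eq_neg_iff_add_eq_0)
  then show ?thesis
    by (simp only: scaleR_eq_0_iff) simp
qed

text \<open>Turns the integrand of \<open>slr_Psi\<close>, applied to a vector, into a scalar
  multiple of the centred function value.\<close>

lemma transpose_outer_mult: "transpose (outer v w) *v c = (v \<bullet> c) *\<^sub>R w"
  by (simp add: vec_eq_iff outer_def transpose_def matrix_vector_mult_def inner_vec_def
      sum_distrib_left sum_distrib_right mult_ac)

text \<open>Allows transposition and application to a fixed vector to be moved under the integral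
  defining \<open>slr_Psi\<close>.\<close>

lemma bounded_linear_transpose_mult:
  fixes c :: "real^'n::finite"
  shows "bounded_linear (\<lambda>A :: real^'m::finite^'n. transpose A *v c)"
  unfolding linear_conv_bounded_linear[symmetric]
  by (rule linearI)
    (simp_all add: vec_eq_iff transpose_def matrix_vector_mult_def distrib_left sum.distrib
      sum_distrib_left mult_ac)

text \<open>All differentiation falls on the Gaussian, so \<open>g\<close> itself may be non-smooth.
  Centring \<open>g\<close> at its mean, as in \<open>slr_Psi\<close>, leaves the derivative
  unchanged because the odd Gaussian integral vanishes.\<close>

lemma has_derivative_slr_mean:
  fixes g :: "real^'n::finite \<Rightarrow> real^'m::finite"
  assumes P: "sym_pos_def P" and mom: "finite_slr_moments g P"
  shows "(slr_mean g P has_derivative (\<lambda>u. slr_gain g P x *v u)) (at x)"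
proof -
  define W where "W = matrix_inv P"
  define a where "a \<xi> = W *v (\<xi> - x)" for \<xi>
  define G where "G \<xi> = gauss_density x P \<xi> *\<^sub>R g \<xi>" for \<xi>
  define \<mu> where "\<mu> = slr_mean g P x"
  define q where "q u = exp (- (u \<bullet> (W *v u)) / 2)" for u
  have [measurable]: "a \<in> borel_measurable lborel"
    unfolding a_def
    by (simp, intro borel_measurable_continuous_onI
        bounded_linear.continuous_on[OF matrix_vector_mul_bounded_linear] continuous_intros)
  have q_pos: "q u > 0" for u
    by (simp add: q_def)
  have shift: "gauss_density (x + u) P \<xi> *\<^sub>R g \<xi> = q u *\<^sub>R (exp (u \<bullet> a \<xi>) *\<^sub>R G \<xi>)" for u \<xi>
    by (simp add: gauss_density_shift[OF P] q_def a_def W_def G_def)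
  \<comment> \<open>Finiteness of the moments at the shifted point \<open>x + u\<close> is
    convergence of the Laplace transform at \<open>u\<close>, after division by the positive factor
    \<open>q u\<close>.\<close>
  have int: "integrable lborel (\<lambda>\<xi>. exp (u \<bullet> a \<xi>) *\<^sub>R G \<xi>)" for u
  proof -
    have "integrable lborel (\<lambda>\<xi>. inverse (q u) *\<^sub>R (gauss_density (x + u) P \<xi> *\<^sub>R g \<xi>))"
      using mom by (intro integrable_scaleR_right) (auto simp: finite_slr_moments_def)
    then show ?thesis
      using q_pos[of u] unfolding shift by (simp add: less_imp_neq[symmetric] flip: mult.assoc)
  qed
  let ?E = "\<lambda>u. \<integral>\<xi>. exp (u \<bullet> a \<xi>) *\<^sub>R G \<xi> \<partial>lborel"
  let ?D = "\<lambda>u. \<integral>\<xi>. (u \<bullet> a \<xi>) *\<^sub>R G \<xi> \<partial>lborel"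
  have E: "(?E has_derivative ?D) (at 0)"
    by (rule has_derivative_laplace_0) (use int in auto)
  have int_lin: "integrable lborel (\<lambda>\<xi>. (u \<bullet> a \<xi>) *\<^sub>R G \<xi>)" for u
    by (rule integrable_inner_scaleR) (use int in auto)
  have D: "?D u = slr_gain g P x *v u" for u
  proof -
    let ?M = "\<lambda>\<xi>. gauss_density x P \<xi> *\<^sub>R outer (\<xi> - x) (g \<xi> - \<mu>)"
    have M: "integrable lborel ?M"
      using mom by (simp add: finite_slr_moments_def \<mu>_def)
    \<comment> \<open>Symmetry of \<open>W\<close> turns the inner product of
      \<open>\<xi> - x\<close> and \<open>W *v u\<close> into \<open>u \<bullet> a \<xi>\<close>;
      the last term comes from the centring.\<close>
    have M_eq: "transpose (?M \<xi>) *v (W *v u) =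
        (u \<bullet> a \<xi>) *\<^sub>R G \<xi> - gauss_density x P \<xi> *\<^sub>R (u \<bullet> a \<xi>) *\<^sub>R \<mu>" for \<xi>
    proof -
      have "transpose (?M \<xi>) *v (W *v u) = gauss_density x P \<xi> *\<^sub>R (transpose (outer (\<xi> - x) (g \<xi> - \<mu>)) *v (W *v u))"
        by (rule linear_scale[OF bounded_linear.linear[OF bounded_linear_transpose_mult]])
      also have "\<dots> = gauss_density x P \<xi> *\<^sub>R (u \<bullet> a \<xi>) *\<^sub>R (g \<xi> - \<mu>)"
        unfolding transpose_outer_mult a_def W_def
        by (simp only: inner_matrix_inv_commute[OF P, of u])
      finally show ?thesis
        by (simp add: G_def scaleR_diff_right mult.commute)
    qed
    have int_M: "integrable lborel (\<lambda>\<xi>. transpose (?M \<xi>) *v (W *v u))"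
      by (rule integrable_bounded_linear[OF bounded_linear_transpose_mult M])
    text \<open>
      The integrability of the first absolute moment of the Gaussian comes for free, as a difference
      of integrable functions.
    \<close>
    have int_\<mu>: "integrable lborel (\<lambda>\<xi>. gauss_density x P \<xi> *\<^sub>R (u \<bullet> a \<xi>) *\<^sub>R \<mu>)"
      using Bochner_Integration.integrable_diff[OF int_lin[of u] int_M]
      unfolding M_eq by (simp only: diff_diff_eq2 add_diff_cancel_left')
    have "slr_gain g P x *v u = transpose (slr_Psi g P x) *v (W *v u)"
      by (simp add: slr_gain_def W_def matrix_vector_mul_assoc)
    also have "\<dots> = (\<integral>\<xi>. transpose (?M \<xi>) *v (W *v u) \<partial>lborel)"
      unfolding slr_Psi_def
      using integral_bounded_linear[OF bounded_linear_transpose_mult M, of "W *v u"] by (simp add: \<mu>_def)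
    also have "\<dots> = ?D u - (\<integral>\<xi>. gauss_density x P \<xi> *\<^sub>R (u \<bullet> a \<xi>) *\<^sub>R \<mu> \<partial>lborel)"
      unfolding M_eq by (rule Bochner_Integration.integral_diff[OF int_lin int_\<mu>])
    also have "\<dots> = ?D u"
      unfolding a_def W_def integral_gauss_density_odd by simp
    finally show ?thesis ..
  qed
  \<comment> \<open>The exponent is a quadratic form in \<open>u\<close>, hence of second order at
    0. With \<open>q 0 = 1\<close>, the product rule below leaves only the derivative of
    \<open>?E\<close>.\<close>
  have q: "(q has_derivative (\<lambda>u. 0)) (at 0)"
    unfolding q_def
    by (auto intro!: derivative_eq_intros bounded_linear.has_derivative[OF matrix_vector_mul_bounded_linear])
  have "((\<lambda>u. q u *\<^sub>R ?E u) has_derivative (\<lambda>u. slr_gain g P x *v u)) (at 0)"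
    using has_derivative_scaleR[OF q E] by (simp add: D q_def)
  moreover have "(\<lambda>u. q u *\<^sub>R ?E u) = (\<lambda>u. slr_mean g P (u + x))"
    unfolding slr_mean_def
    by (simp only: add.commute[of _ x] shift integral_scaleR_right)
  \<comment> \<open>The point 0 is written as \<open>x - x\<close> to match the chain rule with the
    translation \<open>z - x\<close>.\<close>
  ultimately have d: "((\<lambda>u. slr_mean g P (u + x)) has_derivative (\<lambda>u. slr_gain g P x *v u)) (at (x - x))"
    by simp
  have "((\<lambda>z. z - x) has_derivative (\<lambda>u. u)) (at x)"
    by (auto intro!: derivative_eq_intros)
  from diff_chain_at[OF this d] show ?thesis
    by (simp add: o_def)
qed

section \<open>Gradient of the cost\<close>

text \<open>The two terms of the product rule coincide by symmetry of the inverse, whence the factor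
  2.\<close>

lemma has_derivative_weighted_square:
  fixes r :: "'a::real_normed_vector \<Rightarrow> real^'n::finite"
  assumes r: "(r has_derivative r') (at z)" and S: "sym_pos_def S"
  shows "((\<lambda>z. r z \<bullet> (matrix_inv S *v r z)) has_derivative (\<lambda>d. 2 * (r' d \<bullet> (matrix_inv S *v r z)))) (at z)"
proof -
  have "((\<lambda>z. matrix_inv S *v r z) has_derivative (\<lambda>d. matrix_inv S *v r' d)) (at z)"
    by (rule bounded_linear.has_derivative[OF matrix_vector_mul_bounded_linear r])
  from has_derivative_inner[OF r this] show ?thesis
    by (rule has_derivative_eq_rhs) (simp add: fun_eq_iff inner_matrix_inv_commute[OF S, of "r z"])
qed

text \<open>Riesz representation in coordinates: the values of the derivative on the basis are the
  components of the gradient.\<close>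

lemma has_derivative_imp_GDERIV:
  fixes L :: "'a::euclidean_space \<Rightarrow> real"
  assumes "(L has_derivative L') (at z)"
  shows "\<exists>D. GDERIV L z :> D \<and> (\<forall>d. d \<bullet> D = L' d)"
proof -
  interpret bounded_linear L'
    using assms by (rule has_derivative_bounded_linear)
  define D where "D = (\<Sum>b\<in>Basis. L' b *\<^sub>R b)"
  have "d \<bullet> D = L' d" for d
  proof -
    have "L' d = L' (\<Sum>b\<in>Basis. (d \<bullet> b) *\<^sub>R b)"
      by (simp add: euclidean_representation)
    then show ?thesis
      by (simp add: D_def sum scale inner_sum_right mult.commute)
  qed
  then show ?thesis
    using assms by (auto simp: gderiv_def intro!: exI[of _ D])
qed

theorem lemma5p1:
  fixes K :: nat and s :: "nat \<Rightarrow> 'k::finite"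
    and f :: "nat \<Rightarrow> real^'n::finite \<Rightarrow> real^'n" and Q :: "nat \<Rightarrow> real^'n^'n"
    and h :: "nat \<Rightarrow> real^'n \<Rightarrow> real^'m::finite" and R :: "nat \<Rightarrow> real^'m^'m"
    and m0 :: "real^'n" and P0 :: "real^'n^'n"
    and y :: "nat \<Rightarrow> real^'m"
    and xhat :: "real^'n^'k" and P :: "nat \<Rightarrow> real^'n^'n"
    and Omega :: "nat \<Rightarrow> real^'n^'n" and Gamma :: "nat \<Rightarrow> real^'m^'m"
    and F :: "nat \<Rightarrow> real^'n^'n" and H :: "nat \<Rightarrow> real^'n^'m"
    and L :: "real^'n^'k \<Rightarrow> real" and \<Delta> :: "real^'n^'k"
  assumes stacking: "bij_betw s {1..K} UNIV"
    and Omega_def: "Omega = (\<lambda>k. slr_resid (f k) (P k) (xhat $ s k))"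
    and Gamma_def: "Gamma = (\<lambda>k. slr_resid (h k) (P k) (xhat $ s k))"
    and F_def: "F = (\<lambda>k. slr_gain (f k) (P k) (xhat $ s k))"
    and H_def: "H = (\<lambda>k. slr_gain (h k) (P k) (xhat $ s k))"
    and L_def: "L = ipls_cost K s m0 P0 f Q h R y P xhat"
    and Delta_def: "\<Delta> = ipls_update K s m0 P0 f Q h R y P xhat - xhat"
    and P0: "sym_pos_def P0"
    and P: "\<And>k. k \<in> {1..K} \<Longrightarrow> sym_pos_def (P k)"
    and Q: "\<And>k. k \<in> {1..<K} \<Longrightarrow> sym_pos_semidef (Q k)"
    and R: "\<And>k. k \<in> {1..K} \<Longrightarrow> sym_pos_semidef (R k)"
    and QOmega: "\<And>k. k \<in> {1..<K} \<Longrightarrow> sym_pos_def (Q k + Omega k)"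
    and RGamma: "\<And>k. k \<in> {1..K} \<Longrightarrow> sym_pos_def (R k + Gamma k)"
    and moments_f: "\<And>k. k \<in> {1..<K} \<Longrightarrow> finite_slr_moments (f k) (P k)"
    and moments_h: "\<And>k. k \<in> {1..K} \<Longrightarrow> finite_slr_moments (h k) (P k)"
  shows "\<exists>gradL. GDERIV L xhat :> gradL \<and>
    \<Delta> \<bullet> gradL =
      (\<Delta> $ s 1) \<bullet> (matrix_inv P0 *v (xhat $ s 1 - m0))
      + (\<Sum>k=1..<K. (\<Delta> $ s (k + 1) - F k *v (\<Delta> $ s k)) \<bullet>
          (matrix_inv (Q k + Omega k) *v (xhat $ s (k + 1) - slr_mean (f k) (P k) (xhat $ s k))))
      - (\<Sum>k=1..K. (H k *v (\<Delta> $ s k)) \<bullet>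
          (matrix_inv (R k + Gamma k) *v (y k - slr_mean (h k) (P k) (xhat $ s k))))"
proof -
  have nth: "((\<lambda>z. z $ s k) has_derivative (\<lambda>d. d $ s k)) (at xhat)" for k
    by (rule bounded_linear.has_derivative[OF bounded_linear_vec_nth has_derivative_ident])
  \<comment> \<open>The codomain of \<open>g\<close> is left general so that both \<open>f k\<close>
    and \<open>h k\<close> are covered.\<close>
  have mean: "((\<lambda>z. slr_mean g (P k) (z $ s k)) has_derivative
      (\<lambda>d. slr_gain g (P k) (xhat $ s k) *v (d $ s k))) (at xhat)"
    if "k \<in> {1..K}" "finite_slr_moments g (P k)" for k and g :: "real^'n \<Rightarrow> real^'b::finite"
    using diff_chain_at[OF nth has_derivative_slr_mean[OF P[OF that(1)] that(2)]] by (simp add: o_def)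
  have "((\<lambda>z. (z $ s 1 - m0) \<bullet> (matrix_inv P0 *v (z $ s 1 - m0))) has_derivative
      (\<lambda>d. 2 * (d $ s 1 \<bullet> (matrix_inv P0 *v (xhat $ s 1 - m0))))) (at xhat)"
    by (rule has_derivative_weighted_square[OF _ P0]) (auto intro!: derivative_eq_intros nth)
  \<comment> \<open>\<open>Omega\<close> is taken at the fixed \<open>xhat\<close>, so the weights
    are constant in \<open>z\<close> and only the residuals are differentiated.\<close>
  moreover have "((\<lambda>z. \<Sum>k=1..<K. (z $ s (k + 1) - slr_mean (f k) (P k) (z $ s k)) \<bullet>
          (matrix_inv (Q k + Omega k) *v (z $ s (k + 1) - slr_mean (f k) (P k) (z $ s k)))) has_derivative
      (\<lambda>d. \<Sum>k=1..<K. 2 * ((d $ s (k + 1) - F k *v (d $ s k)) \<bullet>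
          (matrix_inv (Q k + Omega k) *v (xhat $ s (k + 1) - slr_mean (f k) (P k) (xhat $ s k)))))) (at xhat)"
    unfolding F_def
    by (intro has_derivative_sum has_derivative_weighted_square[OF _ QOmega] has_derivative_diff nth mean
        moments_f) auto
  \<comment> \<open>The 0 is the derivative of the constant \<open>y k\<close>; the minus sign after
    it becomes the sign of the last sum in the claim.\<close>
  moreover have "((\<lambda>z. \<Sum>k=1..K. (y k - slr_mean (h k) (P k) (z $ s k)) \<bullet>
          (matrix_inv (R k + Gamma k) *v (y k - slr_mean (h k) (P k) (z $ s k)))) has_derivative
      (\<lambda>d. \<Sum>k=1..K. 2 * ((0 - H k *v (d $ s k)) \<bullet>
          (matrix_inv (R k + Gamma k) *v (y k - slr_mean (h k) (P k) (xhat $ s k)))))) (at xhat)"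
    unfolding H_def
    by (intro has_derivative_sum has_derivative_weighted_square[OF _ RGamma] has_derivative_diff mean
        has_derivative_const moments_h) auto
  ultimately have "(L has_derivative (\<lambda>d. 1 / 2 *
      (2 * (d $ s 1 \<bullet> (matrix_inv P0 *v (xhat $ s 1 - m0)))
      + (\<Sum>k=1..<K. 2 * ((d $ s (k + 1) - F k *v (d $ s k)) \<bullet>
          (matrix_inv (Q k + Omega k) *v (xhat $ s (k + 1) - slr_mean (f k) (P k) (xhat $ s k)))))
      + (\<Sum>k=1..K. 2 * ((0 - H k *v (d $ s k)) \<bullet>
          (matrix_inv (R k + Gamma k) *v (y k - slr_mean (h k) (P k) (xhat $ s k)))))))) (at xhat)"
    unfolding L_def ipls_cost_def Omega_def Gamma_def
    by (intro has_derivative_mult_right has_derivative_add)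
  from has_derivative_imp_GDERIV[OF this] obtain D where "GDERIV L xhat :> D"
    and D: "\<Delta> \<bullet> D = 1 / 2 *
      (2 * (\<Delta> $ s 1 \<bullet> (matrix_inv P0 *v (xhat $ s 1 - m0)))
      + (\<Sum>k=1..<K. 2 * ((\<Delta> $ s (k + 1) - F k *v (\<Delta> $ s k)) \<bullet>
          (matrix_inv (Q k + Omega k) *v (xhat $ s (k + 1) - slr_mean (f k) (P k) (xhat $ s k)))))
      + (\<Sum>k=1..K. 2 * ((0 - H k *v (\<Delta> $ s k)) \<bullet>
          (matrix_inv (R k + Gamma k) *v (y k - slr_mean (h k) (P k) (xhat $ s k))))))"
    by blast
  \<comment> \<open>Each factor 2 is pulled out of its sum and cancels the 1/2 of the cost.\<close>
  then show ?thesis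
    by (intro exI[of _ D])
      (simp only: flip: sum_distrib_left, simp add: sum_negf inner_minus_left)
qed

end
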